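(* There exist real numbers $\beta_n\in(1,2)$, $n\ge 2$, such that $U_n=(\beta_n,2)$ for every integer $n\ge 2$. Furthermore, for all integers $n,m\ge2$, $\beta_n<\beta_m$ if and only if $n\triangleleft m$ in the Sharkovskii ordering.
   Context: For $\beta\in(1,2)$ and $x\in I_\beta:=[0,\frac1{\beta-1}]$, a $\beta$-expansion of $x$ is a sequence $(\varepsilon_k)_{k\ge1}\in\{0,1\}^{\mathbb N}$ with $x=\sum_{k\ge1}\varepsilon_k\beta^{-k}$. Let $\Sigma_\beta$ be the set of all sequences in $\{0,1\}^{\mathbb N}$ which are unique $\beta$-expansions, i.e. sequences $(\varepsilon_k)$ such that $(\varepsilon_k)$ is the only $\beta$-expansion of the number $\sum_{k\ge1}\varepsilon_k\beta^{-k}$. For $n\ge2$ put $$U_n=\{\beta\in(1,2):\ \Sigma_\beta \text{ contains a (purely) periodic sequence of smallest period } n\}.$$ The Sharkovskii ordering on $\mathbb N=\{1,2,3,\dots\}$ is the strict total order $$3\rhd5\rhd7\rhd\cdots\rhd2\cdot3\rhd2\cdot5\rhd2\cdot7\rhd\cdots\rhd 4\cdot3\rhd4\cdot5\rhd\cdots\rhd2^n\cdot3\rhd2^n\cdot5\rhd\cdots\rhd8\rhd4\rhd2\rhd1,$$ where $a\rhd b$ means that $a$ comes before $b$ in this list; $b\triangleleft a$ means $a\rhd b$. *)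

theory Defs
  imports Complex_Main
begin

text \<open>Digit sequences are indexed from 0, so that \<open>\<epsilon> k\<close> is the \<open>(k+1)\<close>-st digit,
  with weight \<open>\<beta>\<close> to the power \<open>-(k+1)\<close>.\<close>

definition digit_seqs :: "(nat \<Rightarrow> nat) set" where
  "digit_seqs = {\<epsilon>. \<forall>k. \<epsilon> k \<in> {0, 1}}"

definition beta_expansion :: "real \<Rightarrow> real \<Rightarrow> (nat \<Rightarrow> nat) \<Rightarrow> bool" where
  "beta_expansion \<beta> x \<epsilon> \<longleftrightarrow>
     \<epsilon> \<in> digit_seqs \<and> (\<lambda>k. real (\<epsilon> k) / \<beta> ^ Suc k) sums x"

definition unique_expansions :: "real \<Rightarrow> (nat \<Rightarrow> nat) set" where
  "unique_expansions \<beta> =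
     {\<epsilon> \<in> digit_seqs.
        {\<delta>. beta_expansion \<beta> (\<Sum>k. real (\<epsilon> k) / \<beta> ^ Suc k) \<delta>} = {\<epsilon>}}"

definition is_period :: "(nat \<Rightarrow> 'a) \<Rightarrow> nat \<Rightarrow> bool" where
  "is_period \<epsilon> n \<longleftrightarrow> n > 0 \<and> (\<forall>k. \<epsilon> (k + n) = \<epsilon> k)"

definition smallest_period :: "(nat \<Rightarrow> 'a) \<Rightarrow> nat \<Rightarrow> bool" where
  "smallest_period \<epsilon> n \<longleftrightarrow> is_period \<epsilon> n \<and> (\<forall>m. is_period \<epsilon> m \<longrightarrow> n \<le> m)"

definition U :: "nat \<Rightarrow> real set" where
  "U n = {\<beta>. 1 < \<beta> \<and> \<beta> < 2 \<and> (\<exists>\<epsilon> \<in> unique_expansions \<beta>. smallest_period \<epsilon> n)}"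

text \<open>\<open>a \<rhd> b\<close>: \<open>a\<close> comes before \<open>b\<close> in the Sharkovskii ordering of the positive integers.
  The rules list, in this order: comparison inside a row \<open>2 ^ i * 3, 2 ^ i * 5, \<dots>\<close>,
  comparison between two such rows, rows against the final row of powers of two, and
  comparison inside that final row, which is traversed downwards.\<close>

inductive sharkovskii :: "nat \<Rightarrow> nat \<Rightarrow> bool" (infix "\<rhd>" 50) where
  same_row: "odd p \<Longrightarrow> odd q \<Longrightarrow> 3 \<le> p \<Longrightarrow> p < q \<Longrightarrow> 2 ^ i * p \<rhd> 2 ^ i * q"
| later_row: "odd p \<Longrightarrow> odd q \<Longrightarrow> 3 \<le> p \<Longrightarrow> 3 \<le> q \<Longrightarrow> i < j \<Longrightarrow> 2 ^ i * p \<rhd> 2 ^ j * q"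
| row_power: "odd p \<Longrightarrow> 3 \<le> p \<Longrightarrow> 2 ^ i * p \<rhd> 2 ^ j"
| powers: "j < i \<Longrightarrow> 2 ^ i \<rhd> 2 ^ j"

end

theory Submission
  imports Defs "HOL-Library.Fun_Lexorder"
begin

text \<open>A nonconstant sequence is a unique expansion in base \<open>\<beta>\<close> iff, after every digit, the tail
  (complemented if that digit is 1) has value less than 1. For a periodic sequence it suffices to
  test the lexicographically largest of these tails, and its value is 1 for exactly one base.
  Hence \<open>U n\<close> is an interval whose left end point increases with the lexicographically least
  extremal sequence of smallest period \<open>n\<close>. Apart from \<open>(10)\<^sup>\<omega>\<close>, the extremal sequences below
  \<open>1(10)\<^sup>\<omega>\<close> are exactly the images of those of half the period under an increasing map
  obtained from the Thue--Morse substitution. For odd \<open>n\<close> they all lie above \<open>1(10)\<^sup>\<omega>\<close>, and the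
  least one repeats the prefix of \<open>1(10)\<^sup>\<omega>\<close> of length \<open>n\<close>. The Sharkovskii ordering then
  follows by halving both periods.\<close>

section \<open>Lexicographic order and periods of binary sequences\<close>

text \<open>The lexicographic order is total on Boolean sequences, so negating the reversed strict
  comparison gives the non-strict order.\<close>

abbreviation lex_le :: "(nat \<Rightarrow> bool) \<Rightarrow> (nat \<Rightarrow> bool) \<Rightarrow> bool" where
  "lex_le a b \<equiv> \<not> less_fun b a"

lemma first_difference:
  fixes a b :: "nat \<Rightarrow> 'a"
  assumes "a \<noteq> b"
  obtains k where "a k \<noteq> b k" "\<And>i. i < k \<Longrightarrow> a i = b i"
proof -
  from assms have "\<exists>k. a k \<noteq> b k" by auto
  then have "\<exists>k. a k \<noteq> b k \<and> (\<forall>i<k. a i = b i)"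
    using exists_least_iff[of "\<lambda>k. a k \<noteq> b k"] by simp
  then show ?thesis using that by blast
qed

lemma less_funI_bool:
  fixes a b :: "nat \<Rightarrow> bool"
  assumes "\<And>i. i < k \<Longrightarrow> a i = b i" "\<not> a k" "b k"
  shows "less_fun a b"
  using assms unfolding less_fun_def by auto

lemma less_funE_bool:
  fixes a b :: "nat \<Rightarrow> bool"
  assumes "less_fun a b"
  obtains k where "\<And>i. i < k \<Longrightarrow> a i = b i" "\<not> a k" "b k"
  using assms unfolding less_fun_def by auto

lemma less_fun_linear:
  fixes a b :: "nat \<Rightarrow> bool"
  assumes "a \<noteq> b"
  shows "less_fun a b \<or> less_fun b a"
proof -
  obtain k where "a k \<noteq> b k" "\<And>i. i < k \<Longrightarrow> a i = b i"
    using first_difference[OF assms] by blast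
  then show ?thesis by (metis less_funI_bool)
qed

lemma less_lex_le_trans: "less_fun a b \<Longrightarrow> lex_le b c \<Longrightarrow> less_fun a c"
  by (metis less_fun_linear less_fun_trans)

lemma lex_le_trans: "lex_le a b \<Longrightarrow> lex_le b c \<Longrightarrow> lex_le a c"
  by (metis less_fun_linear less_fun_trans)

lemma lex_max_exists:
  fixes S :: "(nat \<Rightarrow> bool) set"
  assumes "finite S" "S \<noteq> {}"
  shows "\<exists>a\<in>S. \<forall>b\<in>S. lex_le b a"
  using assms
proof (induction rule: finite_ne_induct)
  case (singleton x)
  then show ?case using less_fun_irrefl by auto
next
  case (insert x F)
  then obtain a where a: "a \<in> F" "\<forall>b\<in>F. lex_le b a" by auto
  show ?case
  proof (cases "less_fun a x")
    case True
    then have "\<forall>b\<in>F. lex_le b x" using a(2) by (meson less_fun_trans)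
    then show ?thesis using less_fun_irrefl by auto
  next
    case False
    then show ?thesis using a by auto
  qed
qed

lemma is_period_mult:
  assumes "is_period a n"
  shows "a (k + j * n) = a k"
proof (induction j)
  case (Suc j)
  have "a (k + Suc j * n) = a ((k + j * n) + n)" by (simp add: algebra_simps)
  then show ?case using assms Suc by (simp add: is_period_def)
qed simp

lemma is_period_mod: "is_period a n \<Longrightarrow> a k = a (k mod n)"
  by (metis is_period_mult mod_div_mult_eq)

text \<open>Adding the multiple \<open>p * n\<close> of the known period moves every index beyond
  \<open>p\<close>, where shifting by \<open>q\<close> is already harmless.\<close>

lemma is_period_shift:
  assumes "is_period a n" "\<And>k. a (p + k + q) = a (p + k)" "q > 0"
  shows "is_period a q"
  unfolding is_period_def
proof (intro conjI allI)
  fix k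
  have n: "n > 0" using assms(1) by (simp add: is_period_def)
  then have "p \<le> k + p * n" by (cases n) auto
  then obtain d where d: "k + p * n = p + d" using le_Suc_ex by blast
  have "a (k + q) = a ((k + q) + p * n)" using is_period_mult[OF assms(1)] by simp
  also have "\<dots> = a (p + d + q)" using d by (metis add.assoc add.commute)
  also have "\<dots> = a (k + p * n)" using assms(2) d by simp
  also have "\<dots> = a k" using is_period_mult[OF assms(1)] by simp
  finally show "a (k + q) = a k" .
qed (use assms in simp)

lemma smallest_period_unique: "smallest_period a n \<Longrightarrow> smallest_period a m \<Longrightarrow> n = m"
  unfolding smallest_period_def by (meson le_antisym)

section \<open>Extremal sequences\<close>

text \<open>Comparing with \<open>a k\<close> keeps the tail after a digit 0 and complements it
  after a digit 1, so one upper bound covers both cases of the uniqueness criterion.\<close>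

definition flip_tail :: "(nat \<Rightarrow> bool) \<Rightarrow> nat \<Rightarrow> nat \<Rightarrow> bool" where
  "flip_tail a k i \<longleftrightarrow> a (Suc (k + i)) \<noteq> a k"

text \<open>The condition \<open>\<not> a (n - 1)\<close> makes \<open>a\<close> one of its own flip
  tails, namely the one at \<open>n - 1\<close>; the last condition then makes it the largest of
  them.\<close>

definition extremal :: "nat \<Rightarrow> (nat \<Rightarrow> bool) set" where
  "extremal n = {a. smallest_period a n \<and> a 0 \<and> \<not> a (n - 1) \<and> (\<forall>k. lex_le (flip_tail a k) a)}"

lemma extremalD:
  assumes "a \<in> extremal n"
  shows "smallest_period a n" "is_period a n" "n > 0" "a 0" "\<not> a (n - 1)"
    "lex_le (flip_tail a k) a" "a (k + n) = a k"
  using assms by (auto simp: extremal_def smallest_period_def is_period_def)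

text \<open>The two comparisons with \<open>a p\<close> cancel. Flip tails of a flip tail are thus
  flip tails of the original sequence, so a largest one dominates its own flip tails.\<close>

lemma flip_tail_flip_tail: "flip_tail (flip_tail a p) k = flip_tail a (Suc (p + k))"
  by (auto simp: flip_tail_def fun_eq_iff algebra_simps)

lemma flip_tail_period:
  assumes "is_period a n"
  shows "flip_tail a (k + n) = flip_tail a k"
proof -
  have "a (Suc (k + n + i)) = a (Suc (k + i))" for i
    using assms unfolding is_period_def by (metis add.assoc add.commute add_Suc)
  moreover have "a (k + n) = a k" using assms unfolding is_period_def by simp
  ultimately show ?thesis by (auto simp: flip_tail_def fun_eq_iff)
qed

lemma finite_flip_tails:
  assumes "is_period a n"
  shows "finite (range (flip_tail a))"
proof -
  have "n > 0" using assms by (simp add: is_period_def)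
  have "is_period (flip_tail a) n"
    using assms flip_tail_period[OF assms] by (simp add: is_period_def)
  then have "flip_tail a k \<in> flip_tail a ` {..<n}" for k
    using is_period_mod \<open>n > 0\<close> by (metis imageI lessThan_iff mod_less_divisor)
  then show ?thesis by (metis finite_imageI finite_lessThan finite_subset image_subsetI)
qed

lemma finite_extremal: "finite (extremal n)"
proof (rule finite_subset)
  show "extremal n \<subseteq> (\<lambda>S k. k mod n \<in> S) ` Pow {..<n}"
  proof
    fix a assume a: "a \<in> extremal n"
    have "a = (\<lambda>k. k mod n \<in> {i \<in> {..<n}. a i})"
      using is_period_mod[OF extremalD(2)[OF a]] extremalD(3)[OF a] by (auto simp: fun_eq_iff)
    then show "a \<in> (\<lambda>S k. k mod n \<in> S) ` Pow {..<n}" by blast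
  qed
qed simp

text \<open>A periodic sequence has finitely many flip tails, and a lexicographically largest one is
  extremal. It starts with 1, since otherwise all of them would start with 0 and \<open>a\<close>
  would be constant; it has the same periods as \<open>a\<close>.\<close>

lemma extremal_flip_tail_exists:
  assumes "smallest_period a n" "n \<ge> 2"
  shows "\<exists>p. flip_tail a p \<in> extremal n"
proof -
  have per: "is_period a n" and mn: "\<And>m. is_period a m \<Longrightarrow> n \<le> m"
    using assms by (auto simp: smallest_period_def)
  have "\<exists>b\<in>range (flip_tail a). \<forall>c\<in>range (flip_tail a). lex_le c b"
    by (intro lex_max_exists finite_flip_tails[OF per]) auto
  then obtain p where p: "\<And>k. lex_le (flip_tail a k) (flip_tail a p)" by auto
  have start: "flip_tail a p 0"
  proof (rule ccontr)
    assume "\<not> flip_tail a p 0"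
    then have "\<not> flip_tail a k 0" for k
      using p[of k] less_funI_bool[of 0] by auto
    then have "is_period a 1" by (simp add: flip_tail_def is_period_def)
    then show False using mn assms(2) by fastforce
  qed
  have "is_period (flip_tail a p) m \<longleftrightarrow> is_period a m" for m
  proof
    assume "is_period (flip_tail a p) m"
    then have "a (Suc p + k + m) = a (Suc p + k)" "m > 0" for k
      by (auto simp: is_period_def flip_tail_def add.assoc)
    then show "is_period a m" using is_period_shift[OF per] by blast
  next
    assume m: "is_period a m"
    then have "a (Suc (p + (k + m))) = a (Suc (p + k))" for k
      unfolding is_period_def by (metis add.assoc add_Suc)
    then show "is_period (flip_tail a p) m" using m by (simp add: is_period_def flip_tail_def)
  qed
  then have "smallest_period (flip_tail a p) n" using assms(1) by (simp add: smallest_period_def)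
  moreover have "\<not> flip_tail a p (n - 1)"
    using per assms(2) by (simp add: flip_tail_def is_period_def)
  ultimately have "flip_tail a p \<in> extremal n"
    using start p by (simp add: extremal_def flip_tail_flip_tail)
  then show ?thesis ..
qed

section \<open>Doubling\<close>

text \<open>The word \<open>double a\<close> is \<open>1\<close> followed by the image of \<open>a\<close> under the Thue--Morse substitution.\<close>

definition double :: "(nat \<Rightarrow> bool) \<Rightarrow> nat \<Rightarrow> bool" where
  "double a k \<longleftrightarrow> k = 0 \<or> (if odd k then a (k div 2) else \<not> a (k div 2 - 1))"

lemma double_simps [simp]:
  "double a 0" "double a (Suc 0) = a 0" "double a (Suc (2 * k)) = a k"
  "double a (Suc (Suc (2 * k))) = (\<not> a k)"
  by (auto simp: double_def)

lemma nat_double_cases [case_names zero odd even]: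
  fixes k :: nat
  obtains "k = 0" | l where "k = Suc (2 * l)" | l where "k = Suc (Suc (2 * l))"
proof (cases k)
  case (Suc j)
  then show ?thesis using that(2)[of "j div 2"] that(3)[of "j div 2"]
    by (cases "even j") (auto elim!: evenE oddE)
qed simp

lemma double_mono:
  assumes "less_fun a b"
  shows "less_fun (double a) (double b)"
proof -
  obtain k where k: "\<And>i. i < k \<Longrightarrow> a i = b i" "\<not> a k" "b k"
    using less_funE_bool[OF assms] by blast
  show ?thesis
  proof (rule less_funI_bool[of "Suc (2 * k)"])
    fix i assume "i < Suc (2 * k)"
    then show "double a i = double b i" using k(1) by (cases i rule: nat_double_cases) auto
  qed (use k in auto)
qed

lemma double_less_iff [simp]: "less_fun (double a) (double b) \<longleftrightarrow> less_fun a b"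
  by (metis double_mono less_fun_asym less_fun_linear)

text \<open>Position \<open>Suc (2 * k)\<close> carries the first digit of the pair coming from
  \<open>a k\<close>. The second digit is its complement and becomes the leading 1; on the remaining
  pairs the substitution commutes with complementation.\<close>

lemma flip_tail_double_odd: "flip_tail (double a) (Suc (2 * k)) = double (flip_tail a k)"
proof
  fix i
  have *: "Suc (Suc (2 * k) + Suc (2 * l)) = Suc (2 * (Suc (k + l)))"
    "Suc (Suc (2 * k) + Suc (Suc (2 * l))) = Suc (Suc (2 * (Suc (k + l))))" for l by auto
  show "flip_tail (double a) (Suc (2 * k)) i = double (flip_tail a k) i"
  proof (cases i rule: nat_double_cases)
    case zero
    then show ?thesis by (simp add: flip_tail_def)
  next
    case (odd l)
    then show ?thesis unfolding odd flip_tail_def * double_simps by simp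
  next
    case (even l)
    then show ?thesis unfolding even flip_tail_def * double_simps by simp
  qed
qed

text \<open>At odd positions this is the image of the hypothesis under doubling. The tail after an
  even position starts with a full pair of different digits, while \<open>double a\<close> starts
  with 11.\<close>

lemma lex_le_flip_tail_double:
  assumes "\<And>k. lex_le (flip_tail a k) a" "a 0"
  shows "lex_le (flip_tail (double a) k) (double a)"
proof (cases "odd k")
  case True
  then obtain l where "k = Suc (2 * l)" by (metis oddE Suc_eq_plus1)
  then show ?thesis using assms(1) by (simp add: flip_tail_double_odd)
next
  case False
  then obtain l where l: "k = 2 * l" by auto
  have "flip_tail (double a) k 0 \<noteq> flip_tail (double a) k 1"
    unfolding l flip_tail_def by simp
  moreover have "double a 0" "double a 1" using assms(2) by simp_all
  ultimately have "less_fun (flip_tail (double a) k) (double a)"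
    using less_funI_bool[of 0 "flip_tail (double a) k" "double a"]
      less_funI_bool[of 1 "flip_tail (double a) k" "double a"] by auto
  then show ?thesis using less_fun_asym by blast
qed

text \<open>Positions 0 and 1 both carry 1, whereas the positions \<open>Suc (2 * k)\<close> and
  \<open>Suc (Suc (2 * k))\<close> never agree; this excludes odd periods. Conversely, the leading 1
  recurs at position \<open>m\<close> because the last digit of a period block of \<open>a\<close>
  is 0.\<close>

lemma period_double_iff:
  assumes n: "is_period a n" "\<not> a (n - 1)" and "a 0"
  shows "is_period (double a) m \<longleftrightarrow> even m \<and> is_period a (m div 2)"
proof
  assume m: "is_period (double a) m"
  have "double a m" "double a (Suc m)"
    using m \<open>a 0\<close> unfolding is_period_def
    by (metis add_0 double_simps(1), metis add_Suc add_0 double_simps(2))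
  then have "even m" by (metis double_simps(3,4) oddE Suc_eq_plus1)
  then obtain q where q: "m = 2 * q" by auto
  have "a (k + q) = a k" for k
  proof -
    have "double a (Suc (2 * k) + m) = double a (Suc (2 * k))" using m unfolding is_period_def by blast
    moreover have "Suc (2 * k) + m = Suc (2 * (k + q))" using q by simp
    ultimately show ?thesis by (metis double_simps(3))
  qed
  then show "even m \<and> is_period a (m div 2)" using q m by (auto simp: is_period_def)
next
  assume "even m \<and> is_period a (m div 2)"
  then obtain q where q: "m = 2 * q" "is_period a q" by auto
  have pos: "q > 0" "n > 0" using q(2) n(1) by (auto simp: is_period_def)
  have "a (q - 1) = a ((q - 1) + (n - 1) * q)" using is_period_mult[OF q(2)] by simp
  \<comment> \<open>Both indices equal \<open>n * q - 1\<close>, so the blocks of lengths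
    \<open>q\<close> and \<open>n\<close> end in the same digit.\<close>
  also have "(q - 1) + (n - 1) * q = (n - 1) + (q - 1) * n"
    using pos by (cases q; cases n) (auto simp: algebra_simps)
  also have "a \<dots> = a (n - 1)" using is_period_mult[OF n(1)] .
  finally have "\<not> a (q - 1)" using n(2) by simp
  show "is_period (double a) m"
    unfolding is_period_def
  proof (intro conjI allI)
    fix k
    show "double a (k + m) = double a k"
    proof (cases k rule: nat_double_cases)
      case zero
      have "k + m = Suc (Suc (2 * (q - 1)))" using zero q(1) pos by simp
      then show ?thesis using \<open>\<not> a (q - 1)\<close> zero by simp
    next
      case (odd l)
      then have "k + m = Suc (2 * (l + q))" using q(1) by simp
      then have "double a (k + m) = a (l + q)" by (metis double_simps(3))
      then show ?thesis using odd q(2) by (simp add: is_period_def)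
    next
      case (even l)
      then have "k + m = Suc (Suc (2 * (l + q)))" using q(1) by simp
      then have "double a (k + m) = (\<not> a (l + q))" by (metis double_simps(4))
      then show ?thesis using even q(2) by (simp add: is_period_def)
    qed
  qed (use pos q in simp)
qed

lemma smallest_period_double_iff:
  assumes "is_period a n" "\<not> a (n - 1)" "a 0"
  shows "smallest_period (double a) (2 * m) \<longleftrightarrow> smallest_period a m"
proof -
  have "is_period (double a) k \<longleftrightarrow> even k \<and> is_period a (k div 2)" for k
    using period_double_iff assms by blast
  moreover have "m \<le> k" if "\<forall>j. even j \<and> is_period a (j div 2) \<longrightarrow> 2 * m \<le> j" "is_period a k" for k
    using that(1)[rule_format, of "2 * k"] that(2) by simp
  ultimately show ?thesis by (auto simp: smallest_period_def)
qed

lemma double_extremal: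
  assumes "a \<in> extremal n"
  shows "double a \<in> extremal (2 * n)"
proof -
  note a = extremalD[OF assms]
  have "2 * n - 1 = Suc (2 * (n - 1))" using a(3) by simp
  then have "\<not> double a (2 * n - 1)" using a(5) by simp
  moreover have "smallest_period (double a) (2 * n)"
    using smallest_period_double_iff a by blast
  ultimately show ?thesis
    using lex_le_flip_tail_double[of a] a by (simp add: extremal_def)
qed

text \<open>Extremal sequences below \<open>1(10)\<^sup>\<omega>\<close> can be halved: at the first pair of equal digits
  \<open>c (2k+1) = c (2k+2)\<close>, the tail starting at the last earlier pair with the opposite first digit
  (or \<open>c\<close> itself) would begin with \<open>1(10)\<^sup>r11\<close>, up to complementation.\<close>

lemma ge_double_True:
  assumes "s 0" "\<And>r. r \<le> k \<Longrightarrow> s (Suc (2 * r))" "\<And>r. r < k \<Longrightarrow> \<not> s (Suc (Suc (2 * r)))"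
    "s (Suc (Suc (2 * k)))"
  shows "less_fun (double (\<lambda>_. True)) s"
proof (rule less_funI_bool[of "Suc (Suc (2 * k))"])
  fix i assume i: "i < Suc (Suc (2 * k))"
  show "double (\<lambda>_. True) i = s i"
  proof (cases i rule: nat_double_cases)
    case zero
    then show ?thesis by (simp add: assms(1))
  next
    case (odd l)
    then show ?thesis using i assms(2)[of l] by simp
  next
    case (even l)
    then show ?thesis using i assms(3)[of l] by simp
  qed
qed (simp_all add: assms(4))

lemma halving_alternates:
  assumes "\<And>k. lex_le (flip_tail c k) c" "c 0" "c 1" "lex_le c (double (\<lambda>_. True))"
  shows "c (Suc (Suc (2 * k))) \<noteq> c (Suc (2 * k))"
proof (induction k rule: less_induct)
  case (less k)
  show ?case
  proof
    assume bad: "c (Suc (Suc (2 * k))) = c (Suc (2 * k))"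
    show False
    proof (cases "\<exists>i<k. c (Suc (2 * i)) \<noteq> c (Suc (2 * k))")
      case False
      \<comment> \<open>Here every earlier pair starts with the same digit as pair \<open>k\<close>,
        and pair 0 starts with 1, so \<open>c\<close> itself begins with
        \<open>1(10)\<^sup>k11\<close>.\<close>
      have "c (Suc (2 * k))" using False assms(3) by (cases k) auto
      then have "less_fun (double (\<lambda>_. True)) c"
        using False less bad assms(2) by (intro ge_double_True[of c k]) (auto simp: le_less)
      then show False using assms(4) by simp
    next
      case True
      define i where "i = Max {i. i < k \<and> c (Suc (2 * i)) \<noteq> c (Suc (2 * k))}"
      have fin: "finite {i. i < k \<and> c (Suc (2 * i)) \<noteq> c (Suc (2 * k))}" by simp
      have "i \<in> {i. i < k \<and> c (Suc (2 * i)) \<noteq> c (Suc (2 * k))}"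
        unfolding i_def using True by (intro Max_in fin) auto
      then have i: "i < k" "c (Suc (2 * i)) \<noteq> c (Suc (2 * k))" by auto
      have after: "c (Suc (2 * j)) \<noteq> c (Suc (2 * i))" if "i < j" "j \<le> k" for j
        using Max_ge[OF fin, of j] that i(2) unfolding i_def[symmetric] by (cases "j = k") auto
      \<comment> \<open>By induction the second digit of pair \<open>i\<close> differs from the
        first, so \<open>s\<close> starts with 1. The pairs strictly between \<open>i\<close> and
        \<open>k\<close> turn into 10, and the bad pair \<open>k\<close> turns into 11.\<close>
      define s where "s = flip_tail c (Suc (2 * i))"
      have odd: "s (Suc (2 * r)) \<longleftrightarrow> c (Suc (2 * (Suc (i + r)))) \<noteq> c (Suc (2 * i))"
        and even: "s (Suc (Suc (2 * r))) \<longleftrightarrow> c (Suc (Suc (2 * (Suc (i + r))))) \<noteq> c (Suc (2 * i))" for r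
        by (simp_all add: s_def flip_tail_def)
      have "less_fun (double (\<lambda>_. True)) s"
      proof (rule ge_double_True[of s "k - Suc i"])
        show "s 0" using less[OF i(1)] by (simp add: s_def flip_tail_def)
        show "s (Suc (2 * r))" if "r \<le> k - Suc i" for r
          unfolding odd using that i(1) by (intro after) auto
        show "\<not> s (Suc (Suc (2 * r)))" if "r < k - Suc i" for r
          unfolding even using that i(1) less[of "Suc (i + r)"] after[of "Suc (i + r)"] by auto
        have "Suc (i + (k - Suc i)) = k" using i(1) by simp
        then show "s (Suc (Suc (2 * (k - Suc i))))"
          unfolding even using bad i(2) by metis
      qed
      then show False using assms(1,4) less_lex_le_trans lex_le_trans unfolding s_def by blast
    qed
  qed
qed

text \<open>The digits at odd positions form \<open>a\<close>, and extremality passes back because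
  \<open>double\<close> both preserves and reflects the order. The hypothesis \<open>c 1\<close>
  sets aside \<open>even\<close>, the only extremal sequence starting with 10.\<close>

lemma halving:
  assumes c: "c \<in> extremal (2 * n)" "c 1" "lex_le c (double (\<lambda>_. True))"
  obtains a where "a \<in> extremal n" "c = double a"
proof -
  note cD = extremalD[OF c(1)]
  define a where "a k = c (Suc (2 * k))" for k
  have ca: "c = double a"
  proof
    fix k
    show "c k = double a k"
    proof (cases k rule: nat_double_cases)
      case (even l)
      then show ?thesis using halving_alternates[OF cD(6) cD(4) c(2,3), of l] by (simp add: a_def)
    qed (simp_all add: a_def cD(4))
  qed
  have n: "n > 0" using cD(3) by simp
  have a0: "a 0" using c(2) by (simp add: a_def)
  have "2 * n - 1 = Suc (2 * (n - 1))" using n by simp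
  then have last: "\<not> a (n - 1)" using cD(5) by (simp add: a_def)
  have "is_period a n"
    unfolding is_period_def
  proof (intro conjI allI n)
    fix k
    have "Suc (2 * (k + n)) = Suc (2 * k) + 2 * n" by simp
    then show "a (k + n) = a k" unfolding a_def using cD(7) by metis
  qed
  then have "smallest_period a n"
    using smallest_period_double_iff last a0 cD(1) ca by blast
  moreover have "lex_le (flip_tail a k) a" for k
    using cD(6)[of "Suc (2 * k)"] unfolding ca flip_tail_double_odd by simp
  ultimately have "a \<in> extremal n" using a0 last by (simp add: extremal_def)
  then show ?thesis using ca by (rule that)
qed

section \<open>The lexicographic Sharkovskii ordering\<close>

lemma even_extremal_2: "even \<in> extremal 2"
proof -
  have "smallest_period (even :: nat \<Rightarrow> bool) 2"
    unfolding smallest_period_def is_period_def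
  proof (intro conjI allI impI)
    fix m :: nat assume m: "0 < m \<and> (\<forall>k. even (k + m) = even k)"
    then have "even m" by (metis add_0 even_zero)
    then show "2 \<le> m" using m by (auto elim!: evenE)
  qed auto
  moreover have "flip_tail even k = even" for k
    by (auto simp: flip_tail_def fun_eq_iff)
  ultimately show ?thesis using less_fun_irrefl by (simp add: extremal_def)
qed

text \<open>A change of digits followed by a repetition would give a flip tail starting with 11,
  above \<open>a\<close>, which starts with 10. Hence each change forces another one.\<close>

lemma extremal_not_1:
  assumes "a \<in> extremal n" "\<not> a 1"
  shows "a = even"
proof -
  note a = extremalD[OF assms(1)]
  have step: "a (Suc (Suc k)) \<noteq> a (Suc k)" if "a (Suc k) \<noteq> a k" for k
  proof
    assume "a (Suc (Suc k)) = a (Suc k)"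
    then have "less_fun a (flip_tail a k)"
      using that assms(2) a(4) by (intro less_funI_bool[of 1]) (auto simp: flip_tail_def)
    then show False using a(6) by blast
  qed
  have "a (Suc k) \<noteq> a k" for k
    by (induction k) (use a(4) assms(2) step in auto)
  then have "a k = even k" for k
    by (induction k) (use a(4) in auto)
  then show ?thesis by auto
qed

lemma extremal_gt_even:
  assumes "a \<in> extremal n" "n \<noteq> 2"
  shows "less_fun even a"
proof -
  have "a \<noteq> even"
    using assms extremalD(1) even_extremal_2 smallest_period_unique by metis
  then have "a 1" using extremal_not_1 assms(1) by blast
  then show ?thesis using extremalD(4)[OF assms(1)] by (intro less_funI_bool[of 1]) auto
qed

text \<open>For odd \<open>n = 2 * j + 1\<close> this is the periodic repetition of the word
  \<open>1(10)\<^sup>j\<close>.\<close>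

definition odd_word :: "nat \<Rightarrow> nat \<Rightarrow> bool" where
  "odd_word n k \<longleftrightarrow> k mod n = 0 \<or> odd (k mod n)"

text \<open>The block 11 occurs only at multiples of \<open>n\<close>, and 00 never occurs. So a
  flip tail starting with 11 starts at a multiple of \<open>n\<close> and is the word itself; every
  other flip tail is smaller within its first two digits. The recurrence of 11 also determines the
  smallest period.\<close>

lemma odd_word_extremal:
  assumes "odd n" "n \<ge> 3"
  shows "odd_word n \<in> extremal n"
proof -
  have suc: "Suc k mod n = (if Suc (k mod n) = n then 0 else Suc (k mod n))" for k
    by (rule mod_Suc)
  have two: "k mod n = 0" if "odd_word n k" "odd_word n (Suc k)" for k
  proof (cases "Suc (k mod n) = n")
    case True
    then have "even (k mod n)" using assms(1) by (metis even_Suc)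
    then show ?thesis using that(1) by (simp add: odd_word_def)
  next
    case False
    then show ?thesis using that suc[of k] by (auto simp: odd_word_def)
  qed
  have two': False if "\<not> odd_word n k" "\<not> odd_word n (Suc k)" for k
    using that suc[of k] assms unfolding odd_word_def by (auto split: if_splits)
  have start: "odd_word n 0" "odd_word n 1"
    using assms by (auto simp: odd_word_def)
  have per: "is_period (odd_word n) n"
    using assms by (auto simp: is_period_def odd_word_def)
  have "n \<le> m" if "is_period (odd_word n) m" for m
  proof -
    have "odd_word n m" "odd_word n (Suc m)"
      using that start unfolding is_period_def by (metis add_0, metis add_0 add_Suc One_nat_def)
    then have "m mod n = 0" using two by blast
    moreover have "m > 0" using that by (simp add: is_period_def)
    ultimately show ?thesis by (auto intro!: dvd_imp_le)
  qed
  then have "smallest_period (odd_word n) n" using per by (simp add: smallest_period_def)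
  moreover have "\<not> odd_word n (n - 1)" using assms by (auto simp: odd_word_def)
  moreover have "lex_le (flip_tail (odd_word n) k) (odd_word n)" for k
  proof (cases "flip_tail (odd_word n) k 0 \<and> flip_tail (odd_word n) k 1")
    case True
    then have "\<not> odd_word n k" "odd_word n (Suc k)" "odd_word n (Suc (Suc k))"
      using two'[of "Suc k"] by (auto simp: flip_tail_def)
    then have "Suc k mod n = 0" using two by blast
    then have "n dvd Suc k" by auto
    then obtain q where "Suc k = n * q" ..
    then have "Suc (k + i) = i + q * n" for i by simp
    then have "odd_word n (Suc (k + i)) = odd_word n i" for i
      using is_period_mult[OF per] by metis
    then have "flip_tail (odd_word n) k = odd_word n"
      using \<open>\<not> odd_word n k\<close> by (auto simp: flip_tail_def fun_eq_iff)
    then show ?thesis using less_fun_irrefl by metis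
  next
    case False
    then have "less_fun (flip_tail (odd_word n) k) (odd_word n)"
      using start less_funI_bool[of 0 "flip_tail (odd_word n) k" "odd_word n"]
        less_funI_bool[of 1 "flip_tail (odd_word n) k" "odd_word n"] by auto
    then show ?thesis using less_fun_asym by blast
  qed
  ultimately show ?thesis using start by (simp add: extremal_def)
qed

text \<open>Otherwise the digits after the first fall into pairs of different digits. For odd
  \<open>n\<close> the positions \<open>n\<close> and \<open>Suc n\<close> form such a pair, yet
  periodicity repeats the initial 11 there.\<close>

lemma odd_extremal_gt:
  assumes a: "a \<in> extremal n" and n: "odd n" "n \<ge> 3"
  shows "less_fun (double (\<lambda>_. True)) a"
proof (rule ccontr)
  assume le: "\<not> ?thesis"
  note aD = extremalD[OF a]
  show False
  proof (cases "a 1")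
    case True
    obtain k where k: "n = Suc (2 * k)" using n(1) by (metis oddE Suc_eq_plus1)
    have "a n = a 0" "a (Suc n) = a 1" using aD(7)[of 0] aD(7)[of 1] by auto
    then show False
      using halving_alternates[OF aD(6) aD(4) True le, of k] True aD(4) k by simp
  next
    case False
    then have "n = 2"
      using extremal_not_1 a aD(1) extremalD(1)[OF even_extremal_2] smallest_period_unique by metis
    then show False using n by simp
  qed
qed

lemma double_True_eq_odd_word: "i < n \<Longrightarrow> double (\<lambda>_. True) i = odd_word n i"
  by (auto simp: double_def odd_word_def)

text \<open>Consider the first position where \<open>a\<close> exceeds
  \<open>1(10)\<^sup>\<omega>\<close>. Before \<open>n\<close> it also puts \<open>a\<close> above
  \<open>odd_word n\<close>, which agrees with \<open>1(10)\<^sup>\<omega>\<close> there; later, the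
  two sequences share a whole period block and coincide.\<close>

lemma odd_word_le:
  assumes a: "a \<in> extremal n" and n: "odd n" "n \<ge> 3"
  shows "lex_le (odd_word n) a"
proof -
  obtain k where k: "\<And>i. i < k \<Longrightarrow> double (\<lambda>_. True) i = a i" "\<not> double (\<lambda>_. True) k" "a k"
    using less_funE_bool[OF odd_extremal_gt[OF assms]] by blast
  show ?thesis
  proof (cases "k < n")
    case True
    then have "less_fun (odd_word n) a"
      using k double_True_eq_odd_word[of _ n] by (intro less_funI_bool[of k]) auto
    then show ?thesis using less_fun_asym by blast
  next
    case False
    then have "a i = odd_word n i" if "i < n" for i
      using k(1) double_True_eq_odd_word that by (metis not_less order_less_le_trans)
    then have "a i = odd_word n i" for i
      using is_period_mod[OF extremalD(2)[OF a]] extremalD(3)[OF a]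
        is_period_mod[OF extremalD(2)[OF odd_word_extremal[OF n]]] by (metis mod_less_divisor)
    then have "a = odd_word n" ..
    then show ?thesis using less_fun_irrefl by metis
  qed
qed

text \<open>The shorter word restarts at position \<open>m\<close> with 11. The longer one has 1 at
  the odd position \<open>m\<close> as well, but 0 at \<open>Suc m\<close>.\<close>

lemma odd_word_less:
  assumes "odd m" "odd n" "3 \<le> m" "m < n"
  shows "less_fun (odd_word n) (odd_word m)"
proof (rule less_funI_bool[of "Suc m"])
  have "Suc m < n" using assms by (metis Suc_lessI even_Suc)
  then show "\<not> odd_word n (Suc m)" "odd_word m (Suc m)"
    using assms by (auto simp: odd_word_def mod_Suc)
  fix i assume "i < Suc m"
  then show "odd_word n i = odd_word m i"
    using assms double_True_eq_odd_word[of i m] double_True_eq_odd_word[of i n]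
    by (cases "i = m") (auto simp: odd_word_def)
qed

lemma extremal_nonempty: "n \<ge> 2 \<Longrightarrow> extremal n \<noteq> {}"
proof (induction n rule: less_induct)
  case (less n)
  show ?case
  proof (cases "odd n")
    case True
    then show ?thesis using odd_word_extremal[of n] less(2) by (cases "n = 2") auto
  next
    case False
    then obtain q where q: "n = 2 * q" by auto
    show ?thesis
    proof (cases "q = 1")
      case True
      then show ?thesis using q even_extremal_2 by auto
    next
      case False
      then have "extremal q \<noteq> {}" using q less by auto
      then show ?thesis using q double_extremal by fast
    qed
  qed
qed

text \<open>Doubling is increasing, and an extremal sequence of half the period lies strictly below
  the constant sequence 1. Period 2 is handled by \<open>even\<close>.\<close>

lemma even_extremal_lt:
  assumes "even n" "n \<ge> 2"
  shows "\<exists>a\<in>extremal n. less_fun a (double (\<lambda>_. True))"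
proof (cases "n = 2")
  case True
  have "less_fun even (double (\<lambda>_. True))" by (rule less_funI_bool[of 1]) auto
  then show ?thesis using True even_extremal_2 by blast
next
  case False
  then obtain q where q: "n = 2 * q" "q \<ge> 2" using assms by (auto elim!: evenE)
  then obtain a where a: "a \<in> extremal q" using extremal_nonempty by blast
  have "a \<noteq> (\<lambda>_. True)" using extremalD(5)[OF a] by auto
  moreover have "lex_le a (\<lambda>_. True)" by (auto elim: less_funE_bool)
  ultimately have "less_fun a (\<lambda>_. True)" using less_fun_linear by blast
  then have "less_fun (double a) (double (\<lambda>_. True))" by (rule double_mono)
  then show ?thesis using double_extremal[OF a] q(1) by blast
qed

section \<open>Arithmetic of the Sharkovskii ordering and comparison of extremal sequences\<close>

lemma sharkovskii_ne_2:
  assumes "m \<rhd> n" "n \<ge> 2" shows "m \<noteq> 2"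
proof -
  have "2 ^ i * p \<noteq> 2" if "odd p" "3 \<le> p" for i p :: nat
  proof
    assume "2 ^ i * p = 2"
    then have "p dvd 2" by (metis dvd_triv_right)
    then show False using that dvd_imp_le[of p 2] by simp
  qed
  moreover have "(2::nat) ^ i \<noteq> 2" if "j < i" "2 \<le> (2::nat) ^ j" for i j
  proof -
    have "j \<noteq> 0" using that(2) by (intro notI) simp
    then have "(2::nat) ^ 2 \<le> 2 ^ i" using that(1) by (intro power_increasing) auto
    then show ?thesis by simp
  qed
  ultimately show ?thesis using assms(2) by (cases rule: sharkovskii.cases[OF assms(1)]) simp_all
qed

text \<open>Halving lowers the exponent of 2 by one in each rule. The odd numbers from 3 on form the
  first row, so an even \<open>m\<close> precedes only even numbers and 1.\<close>

lemma sharkovskii_halve: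
  assumes "m \<rhd> n" "even m" "n \<ge> 2"
  shows "even n \<and> m div 2 \<rhd> n div 2"
  using assms(1)
proof cases
  case (same_row p q i)
  then obtain i' where "i = Suc i'" using assms(2) by (cases i) auto
  then show ?thesis using same_row sharkovskii.same_row by simp
next
  case (later_row p q i j)
  then obtain i' where i: "i = Suc i'" using assms(2) by (cases i) auto
  then obtain j' where "j = Suc j'" using later_row by (cases j) auto
  then show ?thesis using i later_row sharkovskii.later_row by simp
next
  case (row_power p i j)
  then obtain i' where i: "i = Suc i'" using assms(2) by (cases i) auto
  obtain j' where "j = Suc j'" using assms(3) row_power by (cases j) auto
  then show ?thesis using i row_power sharkovskii.row_power by simp
next
  case (powers j i)
  obtain j' where j: "j = Suc j'" using assms(3) powers by (cases j) auto
  then obtain i' where "i = Suc i'" using powers by (cases i) auto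
  then show ?thesis using j powers sharkovskii.powers by simp
qed

lemma sharkovskii_odd:
  assumes "m \<rhd> n" "odd m" "odd n" "n \<ge> 2"
  shows "m < n"
  using assms(1)
proof cases
  case (same_row p q i)
  then show ?thesis by simp
next
  case (later_row p q i j)
  then show ?thesis using assms(3) by (cases j) auto
next
  case (row_power p i j)
  then show ?thesis using assms(3,4) by (cases j) auto
next
  case (powers j i)
  then show ?thesis using assms(3,4) by (cases j) auto
qed

lemma odd_part_decomposition:
  fixes n :: nat
  assumes "n > 0"
  shows "\<exists>i p. odd p \<and> n = 2 ^ i * p"
  using assms
proof (induction n rule: less_induct)
  case (less n)
  show ?case
  proof (cases "odd n")
    case True
    then show ?thesis by (metis mult_1 power_0)
  next
    case False
    then obtain q where q: "n = 2 * q" by auto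
    then have "\<exists>i p. odd p \<and> q = 2 ^ i * p" using less by simp
    then obtain i p where "odd p" "q = 2 ^ i * p" by blast
    then have "odd p \<and> n = 2 ^ Suc i * p" using q by simp
    then show ?thesis by blast
  qed
qed

lemma sharkovskii_total:
  assumes "m > 0" "n > 0" "m \<noteq> n"
  shows "m \<rhd> n \<or> n \<rhd> m"
proof -
  obtain i p where m: "odd p" "m = 2 ^ i * p" using odd_part_decomposition assms by blast
  obtain j q where n: "odd q" "n = 2 ^ j * q" using odd_part_decomposition assms by blast
  have p: "p = 1 \<or> 3 \<le> p" using m(1) by presburger
  have q: "q = 1 \<or> 3 \<le> q" using n(1) by presburger
  consider "p = 1" "q = 1" | "p = 1" "3 \<le> q" | "3 \<le> p" "q = 1" | "3 \<le> p" "3 \<le> q"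
    using p q by blast
  then show ?thesis
  proof cases
    case 1
    then show ?thesis using m n assms sharkovskii.powers by (cases i j rule: linorder_cases) auto
  next
    case 2
    then show ?thesis using m n sharkovskii.row_power by auto
  next
    case 3
    then show ?thesis using m n sharkovskii.row_power by auto
  next
    case 4
    show ?thesis
    proof (cases i j rule: linorder_cases)
      case equal
      then show ?thesis using 4 m n assms sharkovskii.same_row by (cases p q rule: linorder_cases) auto
    qed (use 4 m n sharkovskii.later_row in auto)
  qed
qed

text \<open>If \<open>a\<close> lies above \<open>1(10)\<^sup>\<omega>\<close>, either an even
  \<open>n\<close> offers a sequence below it, or both periods are odd and the least sequences
  \<open>odd_word\<close> compare. Otherwise \<open>m\<close> is even and \<open>a\<close> is a
  double, so both periods are halved and induction applies; \<open>n = 2\<close> is settled by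
  \<open>even\<close>.\<close>

lemma sharkovskii_extremal:
  assumes "m \<rhd> n" "m \<ge> 2" "n \<ge> 2" "a \<in> extremal m"
  shows "\<exists>b\<in>extremal n. less_fun b a"
  using assms
proof (induction m arbitrary: n a rule: less_induct)
  case (less m)
  show ?case
  proof (cases "less_fun (double (\<lambda>_. True)) a")
    case gt: True
    show ?thesis
    proof (cases "even n")
      case True
      then show ?thesis using even_extremal_lt less.prems(3) gt less_fun_trans by blast
    next
      case n: False
      then have m: "odd m" using sharkovskii_halve less.prems by blast
      have "m < n" using sharkovskii_odd less.prems m n by blast
      moreover have "m \<ge> 3" using m less.prems(2) by presburger
      ultimately have "odd_word n \<in> extremal n" "less_fun (odd_word n) (odd_word m)"
        "lex_le (odd_word m) a"
        using m n odd_word_extremal odd_word_less odd_word_le less.prems(4) by auto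
      then show ?thesis using less_lex_le_trans by blast
    qed
  next
    case le: False
    have "even m"
    proof (rule ccontr)
      assume "odd m"
      then have "m \<ge> 3" using less.prems(2) by presburger
      then show False using odd_extremal_gt[OF less.prems(4) \<open>odd m\<close>] le by simp
    qed
    have m2: "m \<noteq> 2" using sharkovskii_ne_2 less.prems by blast
    then have gt_even: "less_fun even a" using extremal_gt_even less.prems by blast
    obtain m' where m': "m = 2 * m'" using \<open>even m\<close> by auto
    have n: "even n" "m' \<rhd> n div 2"
      using sharkovskii_halve[OF less.prems(1) \<open>even m\<close> less.prems(3)] m' by simp_all
    show ?thesis
    proof (cases "n = 2")
      case True
      then show ?thesis using gt_even even_extremal_2 by blast
    next
      case False
      have "a 1"
        using extremal_not_1[OF less.prems(4)] gt_even less_fun_irrefl by metis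
      then obtain a' where a': "a' \<in> extremal m'" "a = double a'"
        using halving less.prems(4) le m' by blast
      have "n div 2 \<ge> 2" "m' \<ge> 2" "m' < m"
        using False n(1) less.prems m' m2 by (auto elim!: evenE)
      then obtain b' where "b' \<in> extremal (n div 2)" "less_fun b' a'"
        using less.IH n(2) a'(1) by blast
      then have "double b' \<in> extremal n" "less_fun (double b') a"
        using double_extremal[of b' "n div 2"] double_mono n(1) a'(2) by auto
      then show ?thesis by blast
    qed
  qed
qed

section \<open>Values of binary sequences\<close>

text \<open>The base enters through its reciprocal \<open>x\<close>, which turns the value into a
  power series with coefficients 0 and 1.\<close>

definition bval :: "real \<Rightarrow> (nat \<Rightarrow> bool) \<Rightarrow> real" where
  "bval x a = (\<Sum>k. of_bool (a k) * x ^ Suc k)"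

lemma summable_bval:
  assumes "0 < x" "x < (1::real)"
  shows "summable (\<lambda>k. of_bool (a k) * x ^ Suc k)"
proof (rule summable_comparison_test')
  show "summable (\<lambda>k. x ^ Suc k)"
    using assms by (simp add: summable_Suc_iff summable_geometric)
  show "norm (of_bool (a k) * x ^ Suc k) \<le> x ^ Suc k" if "k \<ge> 0" for k
    using assms by (cases "a k") auto
qed

lemma bval_nonneg:
  assumes "0 < x" "x < 1"
  shows "0 \<le> bval x a"
  unfolding bval_def using assms by (intro suminf_nonneg summable_bval) auto

lemma bval_pos:
  assumes "0 < x" "x < 1" "a i"
  shows "0 < bval x a"
  unfolding bval_def using assms
  by (intro suminf_pos2[of _ i] summable_bval) auto

lemma bval_split:
  assumes "0 < x" "x < 1"
  shows "bval x a = (\<Sum>i<k. of_bool (a i) * x ^ Suc i) + x ^ k * bval x (\<lambda>i. a (k + i))"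
proof -
  have "(\<Sum>i. of_bool (a (i + k)) * x ^ Suc (i + k)) = (\<Sum>i. x ^ k * (of_bool (a (k + i)) * x ^ Suc i))"
    by (intro suminf_cong) (simp add: power_add add.commute)
  also have "\<dots> = x ^ k * bval x (\<lambda>i. a (k + i))"
    unfolding bval_def using assms by (intro suminf_mult summable_bval)
  finally show ?thesis
    unfolding bval_def using suminf_split_initial_segment[OF summable_bval[OF assms], of a k] by simp
qed

lemma bval_True:
  assumes "0 < x" "x < 1"
  shows "bval x (\<lambda>_. True) = x / (1 - x)"
proof -
  have "bval x (\<lambda>_. True) = (\<Sum>k. x * x ^ k)" by (simp add: bval_def)
  also have "\<dots> = x * (\<Sum>k. x ^ k)" using assms by (intro suminf_mult summable_geometric) simp
  finally show ?thesis using assms by (simp add: suminf_geometric)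
qed

lemma bval_Not:
  assumes "0 < x" "x < 1"
  shows "bval x (\<lambda>i. \<not> a i) = x / (1 - x) - bval x a"
proof -
  have "bval x (\<lambda>_. True) - bval x a
      = (\<Sum>k. of_bool True * x ^ Suc k - of_bool (a k) * x ^ Suc k)"
    unfolding bval_def by (intro suminf_diff summable_bval[OF assms])
  also have "\<dots> = bval x (\<lambda>i. \<not> a i)"
    unfolding bval_def by (intro suminf_cong) auto
  finally show ?thesis using bval_True[OF assms] by simp
qed

lemma bval_le:
  assumes "0 < x" "x < 1"
  shows "bval x a \<le> x / (1 - x)"
  using bval_Not[OF assms, of a] bval_nonneg[OF assms, of "\<lambda>i. \<not> a i"] by simp

section \<open>Comparing values with the lexicographic order\<close>

lemma bval_first_difference:
  assumes "0 < x" "x < 1" "\<And>i. i < k \<Longrightarrow> a i = b i" "\<not> a k" "b k"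
  shows "bval x b - bval x a =
    x ^ Suc k * (1 + bval x (\<lambda>i. b (Suc (k + i))) - bval x (\<lambda>i. a (Suc (k + i))))"
proof -
  have "(\<Sum>i<k. of_bool (a i) * x ^ Suc i) = (\<Sum>i<k. of_bool (b i) * x ^ Suc i)"
    using assms(3) by (intro sum.cong) auto
  then show ?thesis
    using bval_split[OF assms(1,2), of a "Suc k"] bval_split[OF assms(1,2), of b "Suc k"] assms(4,5)
    by (simp add: algebra_simps)
qed

text \<open>A digit 0 of the flip tail marks a digit of \<open>a\<close> equal to
  \<open>a k\<close>, so the rest is complemented or kept in the same way.\<close>

lemma flip_tail_suffix:
  "\<not> flip_tail a k j \<Longrightarrow> (\<lambda>i. flip_tail a k (Suc (j + i))) = flip_tail a (Suc (k + j))"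
  by (auto simp: flip_tail_def fun_eq_iff add.assoc)

text \<open>The flip tail of largest value is compared with \<open>c\<close>. After their first
  difference its remainder is again a flip tail, so its value is bounded by the same maximum; this
  gives an inequality for the maximum alone.\<close>

lemma bval_flip_tail_le:
  assumes x: "0 < x" "x < 1" and per: "is_period a n"
    and le: "\<And>k. lex_le (flip_tail a k) c" and c: "bval x c \<le> 1"
  shows "bval x (flip_tail a k) \<le> bval x c"
proof -
  define V where "V = bval x ` range (flip_tail a)"
  have V: "finite V" "V \<noteq> {}" unfolding V_def using finite_flip_tails[OF per] by auto
  have upper: "bval x (flip_tail a k) \<le> Max V" for k
    using V by (intro Max_ge) (auto simp: V_def)
  obtain p where p: "Max V = bval x (flip_tail a p)" using Max_in[OF V] by (auto simp: V_def)
  have "Max V \<le> bval x c"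
  proof (cases "flip_tail a p = c")
    case False
    then have "less_fun (flip_tail a p) c" using le[of p] less_fun_linear by blast
    then obtain j where j: "\<And>i. i < j \<Longrightarrow> flip_tail a p i = c i" "\<not> flip_tail a p j" "c j"
      using less_funE_bool by blast
    have "bval x c - Max V = x ^ Suc j *
        (1 + bval x (\<lambda>i. c (Suc (j + i))) - bval x (flip_tail a (Suc (p + j))))"
      using bval_first_difference[OF x, of j "flip_tail a p" c] j flip_tail_suffix[OF j(2)] p by simp
    moreover have "x ^ Suc j * (1 - Max V) \<le> x ^ Suc j *
        (1 + bval x (\<lambda>i. c (Suc (j + i))) - bval x (flip_tail a (Suc (p + j))))"
      using x bval_nonneg[OF x, of "\<lambda>i. c (Suc (j + i))"] upper[of "Suc (p + j)"]
      by (intro mult_left_mono) auto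
    ultimately have *: "x ^ Suc j * (1 - Max V) \<le> bval x c - Max V" by simp
    have pw: "0 < x ^ Suc j" "x ^ Suc j < 1"
      using x by (simp, intro power_Suc_less_one)
    \<comment> \<open>If \<open>Max V > 1\<close>, the factor below 1 in \<open>*\<close> would give
      \<open>1 - Max V < bval x c - Max V\<close>, against \<open>bval x c \<le> 1\<close>.\<close>
    have "Max V \<le> 1"
    proof (rule ccontr)
      assume "\<not> Max V \<le> 1"
      then have "1 * (1 - Max V) < x ^ Suc j * (1 - Max V)"
        using pw(2) by (intro mult_strict_right_mono_neg) auto
      then show False using * c by simp
    qed
    then have "0 \<le> x ^ Suc j * (1 - Max V)" using pw by (intro mult_nonneg_nonneg) auto
    then show ?thesis using * by simp
  qed (use p in simp)
  then show ?thesis using upper[of k] by simp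
qed

text \<open>After the first difference the rest of \<open>b\<close> is a flip tail, of value at most
  1, while the rest of \<open>c\<close> has positive value. This makes the inequality
  strict.\<close>

lemma bval_extremal_less:
  assumes x: "0 < x" "x < 1" and b: "b \<in> extremal n" and c: "c \<in> extremal m"
    and less: "less_fun b c" and one: "bval x c = 1"
  shows "bval x b < 1"
proof -
  obtain j where j: "\<And>i. i < j \<Longrightarrow> b i = c i" "\<not> b j" "c j"
    using less_funE_bool[OF less] by blast
  have "lex_le (flip_tail b k) c" for k
    using extremalD(6)[OF b] less less_fun_asym lex_le_trans by blast
  then have "bval x (flip_tail b j) \<le> 1"
    using bval_flip_tail_le[OF x extremalD(2)[OF b], of c j] one by simp
  moreover have "(\<lambda>i. b (Suc (j + i))) = flip_tail b j" using j(2) by (auto simp: flip_tail_def)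
  moreover have "0 < bval x (\<lambda>i. c (Suc (j + i)))"
  proof (rule bval_pos[OF x])
    have "m > 0" using extremalD(3)[OF c] .
    \<comment> \<open>\<open>Suc j * m\<close> is a multiple of the period beyond \<open>j\<close>,
      where the initial 1 of \<open>c\<close> recurs.\<close>
    then have "Suc (j + (Suc j * m - Suc j)) = 0 + Suc j * m"
      by (metis add_Suc le_add_diff_inverse mult_le_mono2 mult.right_neutral Suc_leI One_nat_def add_0)
    then show "c (Suc (j + (Suc j * m - Suc j)))"
      using is_period_mult[OF extremalD(2)[OF c], of 0] extremalD(4)[OF c] by metis
  qed
  ultimately have "0 < 1 + bval x (\<lambda>i. c (Suc (j + i))) - bval x (\<lambda>i. b (Suc (j + i)))" by simp
  then have "0 < x ^ Suc j * (1 + bval x (\<lambda>i. c (Suc (j + i))) - bval x (\<lambda>i. b (Suc (j + i))))"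
    using x by (intro mult_pos_pos) auto
  then have "0 < bval x c - bval x b"
    using bval_first_difference[OF x, of j b c] j by simp
  then show ?thesis using one by simp
qed

section \<open>Unique expansions\<close>

text \<open>The greedy algorithm: \<open>r k\<close> is the remainder after \<open>k\<close> digits,
  rescaled by \<open>x ^ k\<close>, and digit 1 is taken whenever it fits. The remainders stay
  bounded, so the error \<open>x ^ N * r N\<close> tends to 0.\<close>

lemma bval_surj:
  assumes x: "1 / 2 \<le> x" "x < 1" and y: "0 \<le> y" "y \<le> x / (1 - x)"
  shows "\<exists>d. bval x d = y"
proof -
  define r where "r = rec_nat y (\<lambda>_ z. z / x - of_bool (x \<le> z))"
  define d where "d k \<longleftrightarrow> x \<le> r k" for k
  have r_simps: "r 0 = y" "r (Suc k) = r k / x - of_bool (d k)" for k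
    by (simp_all add: r_def d_def)
  have bounds: "0 \<le> r k \<and> r k \<le> x / (1 - x)" for k
  proof (induction k)
    case (Suc k)
    show ?case
    proof (cases "d k")
      case True
      then have "1 \<le> r k / x" using x by (simp add: d_def)
      moreover have "r k / x \<le> 1 / (1 - x)"
        using Suc x by (simp add: field_simps)
      moreover have "1 / (1 - x) - 1 = x / (1 - x)" using x by (simp add: field_simps)
      ultimately show ?thesis using True by (simp add: r_simps)
    next
      case False
      then have "r k / x < 1" using x by (simp add: d_def)
      \<comment> \<open>From \<open>1 / 2 \<le> x\<close>: a rescaled remainder below 1 does not
        leave the interval of attainable values.\<close>
      moreover have "1 \<le> x / (1 - x)" using x by simp
      ultimately have "r k / x \<le> x / (1 - x)" by linarith
      then show ?thesis using False Suc x by (simp add: r_simps)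
    qed
  qed (use y r_simps in simp)
  have partial: "(\<Sum>k<N. of_bool (d k) * x ^ Suc k) = y - x ^ N * r N" for N
    by (induction N) (use x in \<open>auto simp: r_simps field_simps\<close>)
  have "(\<lambda>N. x ^ N * r N) \<longlonglongrightarrow> 0"
  proof (rule tendsto_0_le)
    show "(\<lambda>N. x ^ N) \<longlonglongrightarrow> 0" using x by (intro LIMSEQ_power_zero) auto
    show "\<forall>\<^sub>F N in sequentially. norm (x ^ N * r N) \<le> norm (x ^ N) * (x / (1 - x))"
    proof (intro always_eventually allI)
      fix N
      have "x ^ N * r N \<le> x ^ N * (x / (1 - x))" using bounds x by (intro mult_left_mono) auto
      then show "norm (x ^ N * r N) \<le> norm (x ^ N) * (x / (1 - x))"
        using bounds x by (simp add: abs_mult)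
    qed
  qed
  then have "(\<lambda>N. y - x ^ N * r N) \<longlonglongrightarrow> y - 0" by (intro tendsto_diff tendsto_const)
  then have "(\<lambda>k. of_bool (d k) * x ^ Suc k) sums y"
    unfolding sums_def partial by simp
  then show ?thesis unfolding bval_def using sums_unique by metis
qed

lemma bval_flip_tail:
  assumes "0 < x" "x < 1"
  shows "bval x (flip_tail a k) =
    (if a k then x / (1 - x) - bval x (\<lambda>i. a (Suc (k + i))) else bval x (\<lambda>i. a (Suc (k + i))))"
  using bval_Not[OF assms, of "\<lambda>i. a (Suc (k + i))"]
  by (simp add: flip_tail_def[abs_def])

text \<open>Changing digit \<open>k\<close> of \<open>a\<close> while keeping the earlier ones
  requires the remaining digits to make up for it with a value larger or smaller by 1. This value
  lies in \<open>[0, x / (1 - x)]\<close> exactly when the flip tail at \<open>k\<close> has value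
  at least 1.\<close>

lemma bval_inj_iff:
  assumes x: "1 / 2 < x" "x < 1"
  shows "(\<forall>d. bval x d = bval x a \<longrightarrow> d = a) \<longleftrightarrow> (\<forall>k. bval x (flip_tail a k) < 1)"
proof
  assume inj: "\<forall>d. bval x d = bval x a \<longrightarrow> d = a"
  have x0: "0 < x" using x by simp
  show "\<forall>k. bval x (flip_tail a k) < 1"
  proof (intro allI, rule ccontr)
    fix k assume "\<not> bval x (flip_tail a k) < 1"
    then have ge: "bval x (flip_tail a k) \<ge> 1" by simp
    define v where "v = bval x (\<lambda>i. a (Suc (k + i)))"
    define y where "y = (if a k then v + 1 else v - 1)"
    have v: "0 \<le> v" "v \<le> x / (1 - x)"
      unfolding v_def using bval_nonneg bval_le x0 x(2) by blast+
    have "0 \<le> y" "y \<le> x / (1 - x)"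
      using ge v unfolding bval_flip_tail[OF x0 x(2)] y_def v_def by (auto split: if_splits)
    then obtain e where e: "bval x e = y" using bval_surj[of x y] x by auto
    define d where "d i = (if i < k then a i else if i = k then \<not> a k else e (i - Suc k))" for i
    have tail: "(\<lambda>i. d (Suc (k + i))) = e" by (auto simp: d_def)
    have "bval x d = bval x a"
    proof (cases "a k")
      case True
      then have "bval x a - bval x d = x ^ Suc k * (1 + v - y)"
        using bval_first_difference[OF x0 x(2), of k d a] tail e by (simp add: d_def v_def)
      then show ?thesis using True by (simp add: y_def)
    next
      case False
      then have "bval x d - bval x a = x ^ Suc k * (1 + y - v)"
        using bval_first_difference[OF x0 x(2), of k a d] tail e by (simp add: d_def v_def)
      then show ?thesis using False by (simp add: y_def)
    qed
    moreover have "d k \<noteq> a k" by (simp add: d_def)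
    ultimately show False using inj by metis
  qed
next
  assume small: "\<forall>k. bval x (flip_tail a k) < 1"
  have x0: "0 < x" using x by simp
  show "\<forall>d. bval x d = bval x a \<longrightarrow> d = a"
  proof (intro allI impI, rule ccontr)
    fix d assume eq: "bval x d = bval x a" and "d \<noteq> a"
    then obtain k where k: "d k \<noteq> a k" "\<And>i. i < k \<Longrightarrow> d i = a i"
      using first_difference by blast
    define v where "v = bval x (\<lambda>i. a (Suc (k + i)))"
    define w where "w = bval x (\<lambda>i. d (Suc (k + i)))"
    have w: "0 \<le> w" "w \<le> x / (1 - x)"
      unfolding w_def using bval_nonneg bval_le x0 x(2) by blast+
    have s: "(if a k then x / (1 - x) - v else v) < 1"
      using spec[OF small, of k] unfolding bval_flip_tail[OF x0 x(2)] v_def .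
    show False
    proof (cases "a k")
      case True
      then have "x ^ Suc k * (1 + v - w) = 0"
        using bval_first_difference[OF x0 x(2), of k d a] k eq by (simp add: v_def w_def)
      then show False using s w True x0 by simp
    next
      case False
      then have "x ^ Suc k * (1 + w - v) = 0"
        using bval_first_difference[OF x0 x(2), of k a d] k eq by (simp add: v_def w_def)
      then show False using s w False x0 by simp
    qed
  qed
qed

section \<open>Translation between digit sequences and Boolean sequences\<close>

lemma digit_seqs_iff: "\<epsilon> \<in> digit_seqs \<longleftrightarrow> (\<exists>a. \<epsilon> = (\<lambda>k. of_bool (a k)))"
proof
  assume "\<epsilon> \<in> digit_seqs"
  then have "\<epsilon> = (\<lambda>k. of_bool (\<epsilon> k = 1))" by (auto simp: digit_seqs_def fun_eq_iff of_bool_def)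
  then show "\<exists>a. \<epsilon> = (\<lambda>k. of_bool (a k))" by (rule exI[of _ "\<lambda>k. \<epsilon> k = 1"])
qed (auto simp: digit_seqs_def)

lemma beta_expansion_of_bool_iff:
  assumes "1 < \<beta>"
  shows "beta_expansion \<beta> y (\<lambda>k. of_bool (a k)) \<longleftrightarrow> bval (1 / \<beta>) a = y"
proof -
  have eq: "(\<lambda>k. real (of_bool (a k)) / \<beta> ^ Suc k) = (\<lambda>k. of_bool (a k) * (1 / \<beta>) ^ Suc k)"
    by (auto simp: fun_eq_iff power_divide of_bool_def)
  have "summable (\<lambda>k. of_bool (a k) * (1 / \<beta>) ^ Suc k)" using assms by (intro summable_bval) auto
  then have "(\<lambda>k. of_bool (a k) * (1 / \<beta>) ^ Suc k) sums y \<longleftrightarrow> bval (1 / \<beta>) a = y"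
    unfolding bval_def by (auto simp: sums_iff)
  then show ?thesis unfolding beta_expansion_def eq using digit_seqs_iff by blast
qed

lemma of_bool_seq_inject: "(\<lambda>k. of_bool (a k) :: nat) = (\<lambda>k. of_bool (b k)) \<longleftrightarrow> a = b"
  by (auto simp: fun_eq_iff)

lemma unique_expansions_iff:
  assumes "1 < \<beta>" "\<beta> < 2"
  shows "(\<lambda>k. of_bool (a k)) \<in> unique_expansions \<beta> \<longleftrightarrow> (\<forall>k. bval (1 / \<beta>) (flip_tail a k) < 1)"
proof -
  let ?\<epsilon> = "\<lambda>k. of_bool (a k) :: nat"
  define y where "y = (\<Sum>k. real (?\<epsilon> k) / \<beta> ^ Suc k)"
  have y: "y = bval (1 / \<beta>) a"
    unfolding y_def bval_def by (intro suminf_cong) (simp add: power_divide)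
  have "?\<epsilon> \<in> unique_expansions \<beta> \<longleftrightarrow> {\<delta>. beta_expansion \<beta> y \<delta>} = {?\<epsilon>}"
    unfolding unique_expansions_def y_def using digit_seqs_iff by blast
  also have "\<dots> \<longleftrightarrow> (\<forall>\<delta>. beta_expansion \<beta> y \<delta> \<longrightarrow> \<delta> = ?\<epsilon>)"
    using beta_expansion_of_bool_iff[OF assms(1), of y a] y by auto
  also have "\<dots> \<longleftrightarrow> (\<forall>d. beta_expansion \<beta> y (\<lambda>k. of_bool (d k)) \<longrightarrow> d = a)"
  proof (intro iffI allI impI)
    fix d
    assume "\<forall>\<delta>. beta_expansion \<beta> y \<delta> \<longrightarrow> \<delta> = ?\<epsilon>" "beta_expansion \<beta> y (\<lambda>k. of_bool (d k))"
    then show "d = a" using of_bool_seq_inject[of d a] by blast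
  next
    fix \<delta>
    assume *: "\<forall>d. beta_expansion \<beta> y (\<lambda>k. of_bool (d k)) \<longrightarrow> d = a" "beta_expansion \<beta> y \<delta>"
    then obtain d where "\<delta> = (\<lambda>k. of_bool (d k))"
      using digit_seqs_iff[of \<delta>] unfolding beta_expansion_def by blast
    then show "\<delta> = ?\<epsilon>" using * by blast
  qed
  also have "\<dots> \<longleftrightarrow> (\<forall>d. bval (1 / \<beta>) d = bval (1 / \<beta>) a \<longrightarrow> d = a)"
    unfolding beta_expansion_of_bool_iff[OF assms(1)] y ..
  also have "\<dots> \<longleftrightarrow> (\<forall>k. bval (1 / \<beta>) (flip_tail a k) < 1)"
    using assms by (intro bval_inj_iff) (auto simp: field_simps)
  finally show ?thesis .
qed

lemma smallest_period_of_bool: "smallest_period (\<lambda>k. of_bool (a k) :: nat) n \<longleftrightarrow> smallest_period a n"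
  unfolding smallest_period_def is_period_def of_bool_eq_iff ..

text \<open>The bound holds for all flip tails of a unique expansion, in particular for an extremal
  one. Conversely, an extremal sequence dominates its flip tails in value too, so the single bound
  yields all of them.\<close>

lemma U_iff:
  assumes "n \<ge> 2" "1 < \<beta>" "\<beta> < 2"
  shows "\<beta> \<in> U n \<longleftrightarrow> (\<exists>a\<in>extremal n. bval (1 / \<beta>) a < 1)"
proof
  assume "\<beta> \<in> U n"
  then obtain \<epsilon> where \<epsilon>: "\<epsilon> \<in> unique_expansions \<beta>" "smallest_period \<epsilon> n" by (auto simp: U_def)
  then have "\<epsilon> \<in> digit_seqs" by (simp add: unique_expansions_def)
  then obtain a where a: "\<epsilon> = (\<lambda>k. of_bool (a k))" using digit_seqs_iff by blast
  have "smallest_period a n" using \<epsilon>(2) smallest_period_of_bool a by blast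
  then obtain p where "flip_tail a p \<in> extremal n" using extremal_flip_tail_exists assms(1) by blast
  moreover have "bval (1 / \<beta>) (flip_tail a p) < 1"
    using \<epsilon>(1) unique_expansions_iff[OF assms(2,3)] a by blast
  ultimately show "\<exists>a\<in>extremal n. bval (1 / \<beta>) a < 1" by blast
next
  assume "\<exists>a\<in>extremal n. bval (1 / \<beta>) a < 1"
  then obtain a where a: "a \<in> extremal n" "bval (1 / \<beta>) a < 1" by blast
  have "bval (1 / \<beta>) (flip_tail a k) \<le> bval (1 / \<beta>) a" for k
    using assms a extremalD(2,6)[OF a(1)] by (intro bval_flip_tail_le) auto
  then have "(\<lambda>k. of_bool (a k)) \<in> unique_expansions \<beta>"
    using unique_expansions_iff[OF assms(2,3)] a(2) by (meson order.strict_trans1)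
  then show "\<beta> \<in> U n"
    using assms extremalD(1)[OF a(1)] smallest_period_of_bool unfolding U_def by blast
qed

section \<open>Thresholds\<close>

lemma bval_strict_mono:
  assumes "0 < x" "x < y" "y < 1" "a 0"
  shows "bval x a < bval y a"
proof -
  have "bval x (\<lambda>i. a (1 + i)) \<le> bval y (\<lambda>i. a (1 + i))"
    unfolding bval_def using assms
    by (intro suminf_le summable_bval mult_left_mono power_mono) auto
  then have "x * bval x (\<lambda>i. a (1 + i)) \<le> y * bval y (\<lambda>i. a (1 + i))"
    using assms by (intro mult_mono bval_nonneg) auto
  then show ?thesis
    using bval_split[of x a 1] bval_split[of y a 1] assms by simp
qed

lemma continuous_on_bval:
  assumes "0 < u" "v < 1"
  shows "continuous_on {u..v} (\<lambda>x. bval x a)"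
proof -
  have "isCont (\<lambda>x. x * (\<Sum>k. of_bool (a k) * x ^ k)) x" if "x \<in> {u..v}" for x :: real
  proof (intro continuous_mult continuous_ident isCont_powser)
    have x: "0 < x" "x < 1" using that assms by auto
    \<comment> \<open>Continuity of a power series at \<open>x\<close> follows from convergence at a
      point of larger norm; the midpoint of \<open>x\<close> and 1 serves.\<close>
    have "summable (\<lambda>k. of_bool (a k) * ((1 + x) / 2) ^ Suc k)"
      using x by (intro summable_bval) auto
    then have "summable (\<lambda>k. ((1 + x) / 2) * (of_bool (a k) * ((1 + x) / 2) ^ k))"
      by (simp add: mult_ac)
    then show "summable (\<lambda>k. of_bool (a k) * ((1 + x) / 2) ^ k)"
      by (rule summable_mult_D) (use x in simp)
    show "norm x < norm ((1 + x) / 2)" using x by simp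
  qed
  then have "continuous_on {u..v} (\<lambda>x. x * (\<Sum>k. of_bool (a k) * x ^ k))"
    by (intro continuous_at_imp_continuous_on ballI)
  moreover have "x * (\<Sum>k. of_bool (a k) * x ^ k) = bval x a" if "x \<in> {u..v}" for x
  proof -
    have x: "0 < x" "x < 1" using that assms by auto
    have "summable (\<lambda>k. x * (of_bool (a k) * x ^ k))"
      using summable_bval[OF x, of a] by (simp add: mult_ac)
    then have "summable (\<lambda>k. of_bool (a k) * x ^ k)" by (rule summable_mult_D) (use x in simp)
    then have "(\<Sum>k. x * (of_bool (a k) * x ^ k)) = x * (\<Sum>k. of_bool (a k) * x ^ k)"
      by (rule suminf_mult)
    then show ?thesis unfolding bval_def by (simp add: mult_ac)
  qed
  ultimately show ?thesis by (subst continuous_on_cong[OF refl]) auto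
qed

text \<open>At \<open>1 / 2\<close> the constant sequence 1 has value 1 and \<open>a\<close> has a
  digit 0, so its value is below 1. Close to 1 the two ones at positions 0 and \<open>n\<close>
  already exceed 1. The intermediate value theorem does the rest.\<close>

lemma bval_eq_1_exists:
  assumes a: "a \<in> extremal n"
  shows "\<exists>r. 1 / 2 < r \<and> r < 1 \<and> bval r a = 1"
proof -
  note aD = extremalD[OF a]
  \<comment> \<open>By Bernoulli's inequality \<open>v + v ^ Suc n\<close> is at least
    \<open>2 - (n + 2) / (n + 3)\<close>, which exceeds 1.\<close>
  define v where "v = 1 - 1 / (real n + 3)"
  have v: "1 / 2 < v" "v < 1" by (auto simp: v_def field_simps)
  have "0 < bval (1 / 2) (\<lambda>i. \<not> a i)" using aD(5) by (intro bval_pos[of _ _ "n - 1"]) auto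
  then have low: "bval (1 / 2) a < 1" using bval_Not[of "1 / 2" a] by simp
  have "1 + real (Suc n) * (- (1 / (real n + 3))) \<le> (1 + (- (1 / (real n + 3)))) ^ Suc n"
    by (intro Bernoulli_inequality) (simp add: field_simps)
  then have "1 - (real n + 1) / (real n + 3) \<le> v ^ Suc n" by (simp add: v_def algebra_simps)
  moreover have "(real n + 1) / (real n + 3) + 1 / (real n + 3) < 1"
    unfolding add_divide_distrib[symmetric] by simp
  then have "1 < v + (1 - (real n + 1) / (real n + 3))" by (simp add: v_def)
  ultimately have "1 < v + v ^ Suc n" by linarith
  also have "a n" using aD(4) aD(7)[of 0] by simp
  then have "v + v ^ Suc n = (\<Sum>i\<in>{0, n}. of_bool (a i) * v ^ Suc i)"
    using aD(3,4) by simp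
  also have "\<dots> \<le> bval v a"
    unfolding bval_def using v by (intro sum_le_suminf summable_bval) auto
  finally have high: "1 < bval v a" .
  obtain r where r: "1 / 2 \<le> r" "r \<le> v" "bval r a = 1"
    using IVT'[of "\<lambda>x. bval x a" "1 / 2" 1 v] low high v continuous_on_bval[of "1 / 2" v a] by auto
  then have "r \<noteq> 1 / 2" using low by (metis less_irrefl)
  then show ?thesis using r v by (intro exI[of _ r]) auto
qed

text \<open>For extremal \<open>a\<close> the choice is unique, since the value strictly increases
  with \<open>r\<close>. It is the reciprocal of a base, so larger thresholds belong to smaller
  bases.\<close>

definition threshold :: "(nat \<Rightarrow> bool) \<Rightarrow> real" where
  "threshold a = (SOME r. 1 / 2 < r \<and> r < 1 \<and> bval r a = 1)"

lemma threshold: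
  assumes "a \<in> extremal n"
  shows "1 / 2 < threshold a" "threshold a < 1" "bval (threshold a) a = 1"
  using someI_ex[OF bval_eq_1_exists[OF assms]] unfolding threshold_def by blast+

lemma bval_less_1_iff:
  assumes "a \<in> extremal n" "0 < x" "x < 1"
  shows "bval x a < 1 \<longleftrightarrow> x < threshold a"
proof -
  note t = threshold[OF assms(1)] and a0 = extremalD(4)[OF assms(1)]
  show ?thesis
    using bval_strict_mono[of x "threshold a" a] bval_strict_mono[of "threshold a" x a] t a0 assms
    by (cases x "threshold a" rule: linorder_cases) auto
qed

theorem theorem1p3:
  shows "\<exists>\<beta> :: nat \<Rightarrow> real.
    (\<forall>n\<ge>2. \<beta> n \<in> {1<..<2} \<and> U n = {\<beta> n<..<2}) \<and>
    (\<forall>n\<ge>2. \<forall>m\<ge>2. \<beta> n < \<beta> m \<longleftrightarrow> m \<rhd> n)"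
proof -
  \<comment> \<open>\<open>\<beta>\<close> lies in \<open>U n\<close> iff \<open>1 / \<beta>\<close>
    is below some threshold, hence below the largest; the end point is therefore
    \<open>1 / r n\<close>.\<close>
  define r where "r n = Max (threshold ` extremal n)" for n
  have attained: "\<exists>a\<in>extremal n. r n = threshold a" if "n \<ge> 2" for n
  proof -
    have "r n \<in> threshold ` extremal n"
      unfolding r_def using finite_extremal extremal_nonempty[OF that] by (intro Max_in) auto
    then show ?thesis by blast
  qed
  have upper: "threshold a \<le> r n" if "a \<in> extremal n" for a n
    unfolding r_def using finite_extremal that by (intro Max_ge) auto
  have bounds: "1 / 2 < r n \<and> r n < 1" if "n \<ge> 2" for n
    using attained[OF that] threshold by auto
  have U: "U n = {1 / r n<..<2}" if n: "n \<ge> 2" for n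
  proof (intro set_eqI)
    fix \<beta>
    show "\<beta> \<in> U n \<longleftrightarrow> \<beta> \<in> {1 / r n<..<2}"
    proof (cases "1 < \<beta> \<and> \<beta> < 2")
      case True
      then have "\<beta> \<in> U n \<longleftrightarrow> (\<exists>a\<in>extremal n. 1 / \<beta> < threshold a)"
        using U_iff[OF n] bval_less_1_iff[of _ n "1 / \<beta>"] by auto
      also have "\<dots> \<longleftrightarrow> 1 / \<beta> < r n"
      proof
        assume "\<exists>a\<in>extremal n. 1 / \<beta> < threshold a"
        then show "1 / \<beta> < r n" using upper order.strict_trans2 by blast
      next
        assume "1 / \<beta> < r n"
        then show "\<exists>a\<in>extremal n. 1 / \<beta> < threshold a" using attained[OF n] by auto
      qed
      also have "\<dots> \<longleftrightarrow> 1 / r n < \<beta>" using True bounds[OF n] by (simp add: field_simps)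
      finally show ?thesis using True by simp
    next
      case False
      have "1 < 1 / r n" using bounds[OF n] by simp
      then show ?thesis using False by (auto simp: U_def)
    qed
  qed
  have less: "1 / r n < 1 / r m" if mn: "m \<rhd> n" "n \<ge> 2" "m \<ge> 2" for m n
  proof -
    \<comment> \<open>With \<open>a\<close> attaining the maximum for \<open>m\<close>, any extremal
      sequence of period \<open>n\<close> below \<open>a\<close> has a still larger
      threshold.\<close>
    obtain a where a: "a \<in> extremal m" "r m = threshold a" using attained \<open>m \<ge> 2\<close> by blast
    obtain b where b: "b \<in> extremal n" "less_fun b a"
      using sharkovskii_extremal[OF mn(1,3,2) a(1)] by blast
    note t = threshold[OF a(1)]
    have "bval (threshold a) b < 1" using bval_extremal_less[OF _ t(2) b(1) a(1) b(2) t(3)] t by simp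
    then have "threshold a < threshold b" using bval_less_1_iff[OF b(1)] t by simp
    then have "r m < r n" using a(2) upper[OF b(1)] by simp
    then show ?thesis using bounds[of m] bounds[of n] mn by (intro divide_strict_left_mono) auto
  qed
  have "1 / r n < 1 / r m \<longleftrightarrow> m \<rhd> n" if "n \<ge> 2" "m \<ge> 2" for n m
  proof
    assume *: "1 / r n < 1 / r m"
    \<comment> \<open>Totality gives the converse, as \<open>n \<rhd> m\<close> would reverse the
      strict inequality.\<close>
    then have "m \<rhd> n \<or> n \<rhd> m" using sharkovskii_total[of m n] that by auto
    then show "m \<rhd> n" using * less[of n m] that by auto
  qed (use less that in auto)
  moreover have "1 / r n \<in> {1<..<2}" if "n \<ge> 2" for n
    using bounds[OF that] by (simp add: field_simps)
  ultimately show ?thesis using U by (intro exI[of _ "\<lambda>n. 1 / r n"]) auto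
qed

end
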